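(* Let $X_c=\{x_0,x_1,\dots,x_{m_c}\}$ and $X_d=\{\tilde x_0,\tilde x_1,\dots,\tilde x_{m_d}\}$. If $c\in\mathbb{R}^{m_d}_{LC}\langle\langle X_c\rangle\rangle$ and $d\in\mathbb{R}^{m_c}_{LC}\langle\langle X_d\rangle\rangle$, then $c@d\in\mathbb{R}^{m_d}_{LC}\langle\langle X_c\rangle\rangle$.
   Context: For an alphabet $X$ of noncommuting letters, $X^*$ is the monoid of words including the empty word $\emptyset$, $|\eta|$ is word length, and $\mathbb{R}^\ell\langle\langle X\rangle\rangle$ is the set of formal power series $c:X^*\to\mathbb{R}^\ell$, $c=\sum_\eta(c,\eta)\eta$, with component series $c_i$. $\mathbb{R}^\ell_{LC}\langle\langle X\rangle\rangle$ is the subset of locally convergent series: those for which there exist $K_c,M_c>0$ with $|(c,\eta)|\le K_cM_c^{|\eta|}|\eta|!$ for all $\eta\in X^*$, where $|z|=\max_i|z_i|$ for $z\in\mathbb{R}^\ell$. The shuffle product $\sqcup\!\sqcup$ is the bilinear product with $(x_i\eta)\sqcup\!\sqcup(x_j\xi)=x_i(\eta\sqcup\!\sqcup(x_j\xi))+x_j((x_i\eta)\sqcup\!\sqcup\xi)$ and $\eta\sqcup\!\sqcup\emptyset=\emptyset\sqcup\!\sqcup\eta=\eta$. Composition product: for $d\in\mathbb{R}^{\ell}\langle\langle X_d\rangle\rangle$ and $e\in\mathbb{R}^{m_d}\langle\langle X_c\rangle\rangle$, $d\circ e=\sum_{\eta\in X_d^*}(d,\eta)\,\psi_e(\eta)(1)\in\mathbb{R}^\ell\langle\langle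 X_c\rangle\rangle$, where $\psi_e$ is the continuous (in the ultrametric sense) algebra homomorphism from $\mathbb{R}\langle\langle X_d\rangle\rangle$ to $\mathrm{End}(\mathbb{R}\langle\langle X_c\rangle\rangle)$ with $\psi_e(\tilde x_i\eta)=\psi_e(\tilde x_i)\circ\psi_e(\eta)$, $\psi_e(\tilde x_i)(f)=x_0(e_i\sqcup\!\sqcup f)$ for $i=0,\dots,m_d$ with $e_0:=1$, and $\psi_e(\emptyset)=\mathrm{id}$. Modified composition product: for $c\in\mathbb{R}^\ell\langle\langle X_c\rangle\rangle$ and $e\in\mathbb{R}^{m_c}\langle\langle X_c\rangle\rangle$, $c\,\tilde\circ\,e=\sum_{\eta\in X_c^*}(c,\eta)\,\phi_e(\eta)(1)$, where $\phi_e$ is the continuous algebra homomorphism from $\mathbb{R}\langle\langle X_c\rangle\rangle$ to $\mathrm{End}(\mathbb{R}\langle\langle X_c\rangle\rangle)$ with $\phi_e(x_i\eta)=\phi_e(x_i)\circ\phi_e(\eta)$, $\phi_e(x_i)(f)=x_if+x_0(e_i\sqcup\!\sqcup f)$ for $i=0,\dots,m_c$ with $e_0:=0$, and $\phi_e(\emptyset)=\mathrm{id}$. Feedback product: $c@d\in\mathbb{R}^{m_d}\langle\langle X_c\rangle\rangle$ is the generating series of the closed-loop system $y=F_c[v]$, $v=u+F_d[y]$, i.e. $y=F_{c@d}[u]$, where $F_c$ denotes the Fliess operator (Chen–Fliess series) with generating series $c$. As a formal series it is the unique fixed point $e=c@d$ of the map $e\mapsto c\,\tilde\circ\,(d\circ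 e)$ (which is a contraction in the ultrametric sense). *)

theory Defs
  imports "HOL-Analysis.Analysis" "HOL-Library.Groups_Big_Fun"
begin

text \<open>
  A formal power series over an alphabet \<open>'x\<close> is a function on words (lists of letters).
  The alphabet \<open>{x\<^sub>0, x\<^sub>1, \<dots>, x\<^sub>m}\<close> is \<open>'m option\<close> with \<open>'m\<close> a finite type and
  \<open>m = CARD('m) \<ge> 1\<close>: \<open>None\<close> is the drift letter \<open>x\<^sub>0\<close> and \<open>Some i\<close> are the letters
  \<open>x\<^sub>1, \<dots>, x\<^sub>m\<close>, so the same index type labels the components of vectors in \<open>real ^ 'm\<close>.
  All infinite sums below are coefficientwise and have only finitely many nonzero terms
  (shown in \<open>finite_support_shuffle\<close>, \<open>finite_support_comp_prod\<close>,
  \<open>finite_support_mod_comp_prod\<close>), which is where \<open>Sum_any\<close> is meaningful.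
\<close>

type_synonym ('x, 'b) series = "'x list \<Rightarrow> 'b"

definition word_series :: "'x list \<Rightarrow> ('x, real) series" where
  "word_series \<eta> = (\<lambda>\<nu>. if \<nu> = \<eta> then 1 else 0)"

definition lmul :: "'x \<Rightarrow> ('x, real) series \<Rightarrow> ('x, real) series" where
  "lmul x f = (\<lambda>\<nu>. case \<nu> of [] \<Rightarrow> 0 | y # \<mu> \<Rightarrow> if y = x then f \<mu> else 0)"

definition component :: "('x, real ^ 'l) series \<Rightarrow> 'l \<Rightarrow> ('x, real) series" where
  "component c i = (\<lambda>\<eta>. c \<eta> $ i)"

text \<open>On \<open>real ^ 'l\<close>, \<open>infnorm z\<close> is the maximum of the \<open>\<bar>z $ i\<bar>\<close>.\<close>

definition locally_convergent :: "('x, real ^ 'l) series \<Rightarrow> bool" where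
  "locally_convergent c \<longleftrightarrow>
     (\<exists>K>0. \<exists>M>0. \<forall>\<eta>. infnorm (c \<eta>) \<le> K * M ^ length \<eta> * fact (length \<eta>))"

fun word_shuffle :: "'x list \<Rightarrow> 'x list \<Rightarrow> ('x, real) series" where
  "word_shuffle [] \<xi> = word_series \<xi>"
| "word_shuffle (x # \<eta>) [] = word_series (x # \<eta>)"
| "word_shuffle (x # \<eta>) (y # \<xi>) =
     (\<lambda>\<nu>. lmul x (word_shuffle \<eta> (y # \<xi>)) \<nu> + lmul y (word_shuffle (x # \<eta>) \<xi>) \<nu>)"

definition shuffle_prod :: "('x, real) series \<Rightarrow> ('x, real) series \<Rightarrow> ('x, real) series" where
  "shuffle_prod f g = (\<lambda>\<nu>. Sum_any (\<lambda>(\<eta>, \<xi>). f \<eta> * g \<xi> * word_shuffle \<eta> \<xi> \<nu>))"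

text \<open>
  \<open>psi e \<eta>\<close> and \<open>phi e \<eta>\<close> are the endomorphisms assigned to the word \<open>\<eta>\<close>; the conventions for
  the component with index 0 are \<open>e\<^sub>0 = 1\<close> for \<open>psi\<close> and \<open>e\<^sub>0 = 0\<close> for \<open>phi\<close>.
\<close>

primrec psi_letter ::
  "('p option, real ^ 'q) series \<Rightarrow> 'q option \<Rightarrow>
     ('p option, real) series \<Rightarrow> ('p option, real) series" where
  "psi_letter e None = (\<lambda>f. lmul None (shuffle_prod (word_series []) f))"
| "psi_letter e (Some i) = (\<lambda>f. lmul None (shuffle_prod (component e i) f))"

primrec psi ::
  "('p option, real ^ 'q) series \<Rightarrow> 'q option list \<Rightarrow>
     ('p option, real) series \<Rightarrow> ('p option, real) series" where
  "psi e [] = id"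
| "psi e (x # \<eta>) = psi_letter e x \<circ> psi e \<eta>"

definition comp_prod ::
  "('q option, real ^ 'l) series \<Rightarrow> ('p option, real ^ 'q) series \<Rightarrow>
     ('p option, real ^ 'l) series" where
  "comp_prod d e = (\<lambda>\<nu>. Sum_any (\<lambda>\<eta>. psi e \<eta> (word_series []) \<nu> *\<^sub>R d \<eta>))"

primrec phi_letter ::
  "('p option, real ^ 'p) series \<Rightarrow> 'p option \<Rightarrow>
     ('p option, real) series \<Rightarrow> ('p option, real) series" where
  "phi_letter e None = (\<lambda>f \<nu>. lmul None f \<nu> + lmul None (shuffle_prod (\<lambda>_. 0) f) \<nu>)"
| "phi_letter e (Some i) =
     (\<lambda>f \<nu>. lmul (Some i) f \<nu> + lmul None (shuffle_prod (component e i) f) \<nu>)"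

primrec phi ::
  "('p option, real ^ 'p) series \<Rightarrow> 'p option list \<Rightarrow>
     ('p option, real) series \<Rightarrow> ('p option, real) series" where
  "phi e [] = id"
| "phi e (x # \<eta>) = phi_letter e x \<circ> phi e \<eta>"

definition mod_comp_prod ::
  "('p option, real ^ 'l) series \<Rightarrow> ('p option, real ^ 'p) series \<Rightarrow>
     ('p option, real ^ 'l) series" where
  "mod_comp_prod c e = (\<lambda>\<nu>. Sum_any (\<lambda>\<eta>. phi e \<eta> (word_series []) \<nu> *\<^sub>R c \<eta>))"

text \<open>Well defined by \<open>ex1_feedback\<close> below.\<close>

definition feedback_prod ::
  "('p option, real ^ 'q) series \<Rightarrow> ('q option, real ^ 'p) series \<Rightarrow>
     ('p option, real ^ 'q) series" where
  "feedback_prod c d = (THE e. mod_comp_prod c (comp_prod d e) = e)"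


subsection \<open>The sums are locally finite\<close>

lemma lmul_Nil [simp]: "lmul x f [] = 0"
  by (simp add: lmul_def)

lemma lmul_Cons [simp]: "lmul x f (y # \<mu>) = (if y = x then f \<mu> else 0)"
  by (simp add: lmul_def)

lemma word_shuffle_length:
  "word_shuffle \<eta> \<xi> \<nu> \<noteq> 0 \<Longrightarrow> length \<nu> = length \<eta> + length \<xi>"
proof (induction \<eta> \<xi> arbitrary: \<nu> rule: word_shuffle.induct)
  case (3 x \<eta> y \<xi>)
  show ?case
  proof (cases \<nu>)
    case Nil
    then show ?thesis using "3.prems" by simp
  next
    case (Cons z \<mu>)
    then have "word_shuffle \<eta> (y # \<xi>) \<mu> \<noteq> 0 \<or> word_shuffle (x # \<eta>) \<xi> \<mu> \<noteq> 0"
      using "3.prems" by (auto split: if_splits)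
    then show ?thesis
      using "3.IH"[of \<mu>] Cons by auto
  qed
qed (auto simp: word_series_def split: if_splits)

lemma finite_words_upto: "finite {\<eta> :: 'x :: finite list. length \<eta> \<le> n}"
  using finite_lists_length_le[of "UNIV :: 'x set" n] by simp

lemma finite_support_shuffle:
  fixes f g :: "('x :: finite, real) series"
  shows "finite {z. (case z of (\<eta>, \<xi>) \<Rightarrow> f \<eta> * g \<xi> * word_shuffle \<eta> \<xi> \<nu>) \<noteq> 0}"
proof (rule finite_subset)
  let ?W = "{\<eta> :: 'x list. length \<eta> \<le> length \<nu>}"
  show "{z. (case z of (\<eta>, \<xi>) \<Rightarrow> f \<eta> * g \<xi> * word_shuffle \<eta> \<xi> \<nu>) \<noteq> 0} \<subseteq> ?W \<times> ?W"
  proof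
    fix z assume z: "z \<in> {z. (case z of (\<eta>, \<xi>) \<Rightarrow> f \<eta> * g \<xi> * word_shuffle \<eta> \<xi> \<nu>) \<noteq> 0}"
    obtain \<eta> \<xi> where "z = (\<eta>, \<xi>)" by (cases z)
    with z word_shuffle_length[of \<eta> \<xi> \<nu>] show "z \<in> ?W \<times> ?W"
      by simp
  qed
  show "finite (?W \<times> ?W)"
    by (intro finite_cartesian_product finite_words_upto)
qed

lemma shuffle_eq_0:
  assumes "\<And>\<xi>. length \<xi> \<le> length \<nu> \<Longrightarrow> g \<xi> = 0"
  shows "shuffle_prod f g \<nu> = 0"
proof -
  have "f \<eta> * g \<xi> * word_shuffle \<eta> \<xi> \<nu> = 0" for \<eta> \<xi>
    using assms[of \<xi>] word_shuffle_length[of \<eta> \<xi> \<nu>]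
    by (cases "word_shuffle \<eta> \<xi> \<nu> = 0") simp_all
  then show ?thesis
    by (simp only: shuffle_prod_def case_prod_unfold) simp
qed

lemma psi_eq_0: "length \<nu> < length \<eta> \<Longrightarrow> psi e \<eta> f \<nu> = 0"
proof (induction \<eta> arbitrary: \<nu>)
  case (Cons x \<eta>)
  show ?case
  proof (cases \<nu>)
    case Nil
    then show ?thesis by (cases x) auto
  next
    case (Cons y \<mu>)
    have "shuffle_prod g (psi e \<eta> f) \<mu> = 0" for g
      by (rule shuffle_eq_0) (use Cons.prems Cons.IH Cons in auto)
    then show ?thesis using Cons by (cases x) auto
  qed
qed simp

lemma phi_eq_0: "length \<nu> < length \<eta> \<Longrightarrow> phi e \<eta> f \<nu> = 0"
proof (induction \<eta> arbitrary: \<nu>)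
  case (Cons x \<eta>)
  show ?case
  proof (cases \<nu>)
    case Nil
    then show ?thesis by (cases x) auto
  next
    case (Cons y \<mu>)
    have "shuffle_prod g (phi e \<eta> f) \<mu> = 0" for g
      by (rule shuffle_eq_0) (use Cons.prems Cons.IH Cons in auto)
    moreover have "phi e \<eta> f \<mu> = 0"
      using Cons.prems Cons.IH Cons by auto
    ultimately show ?thesis using Cons by (cases x) auto
  qed
qed simp

lemma finite_support_comp_prod:
  fixes d :: "('q :: finite option, real ^ 'l) series"
  shows "finite {\<eta>. psi e \<eta> f \<nu> *\<^sub>R d \<eta> \<noteq> 0}"
proof (rule finite_subset[OF _ finite_words_upto])
  show "{\<eta>. psi e \<eta> f \<nu> *\<^sub>R d \<eta> \<noteq> 0} \<subseteq> {\<eta>. length \<eta> \<le> length \<nu>}"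
    by (auto intro: ccontr simp: psi_eq_0)
qed

lemma finite_support_mod_comp_prod:
  fixes c :: "('p :: finite option, real ^ 'l) series"
  shows "finite {\<eta>. phi e \<eta> f \<nu> *\<^sub>R c \<eta> \<noteq> 0}"
proof (rule finite_subset[OF _ finite_words_upto])
  show "{\<eta>. phi e \<eta> f \<nu> *\<^sub>R c \<eta> \<noteq> 0} \<subseteq> {\<eta>. length \<eta> \<le> length \<nu>}"
    by (auto intro: ccontr simp: phi_eq_0)
qed


subsection \<open>The feedback equation has exactly one solution\<close>

definition agree :: "nat \<Rightarrow> ('x, 'b) series \<Rightarrow> ('x, 'b) series \<Rightarrow> bool" where
  "agree n f g \<longleftrightarrow> (\<forall>\<nu>. length \<nu> < n \<longrightarrow> f \<nu> = g \<nu>)"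

lemma shuffle_cong:
  assumes "agree (Suc (length \<nu>)) f f'" "agree (Suc (length \<nu>)) g g'"
  shows "shuffle_prod f g \<nu> = shuffle_prod f' g' \<nu>"
proof -
  have "f \<eta> * g \<xi> * word_shuffle \<eta> \<xi> \<nu> = f' \<eta> * g' \<xi> * word_shuffle \<eta> \<xi> \<nu>" for \<eta> \<xi>
    using assms word_shuffle_length[of \<eta> \<xi> \<nu>]
    by (cases "word_shuffle \<eta> \<xi> \<nu> = 0") (auto simp: agree_def)
  then show ?thesis
    by (simp only: shuffle_prod_def case_prod_unfold)
qed

lemma psi_cong: "agree (length \<nu>) e e' \<Longrightarrow> psi e \<eta> f \<nu> = psi e' \<eta> f \<nu>"
proof (induction \<eta> arbitrary: \<nu>)
  case (Cons x \<eta>)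
  show ?case
  proof (cases \<nu>)
    case Nil
    then show ?thesis by (cases x) auto
  next
    case (Cons y \<mu>)
    have ag: "agree (Suc (length \<mu>)) (psi e \<eta> f) (psi e' \<eta> f)"
      unfolding agree_def using Cons.prems Cons.IH Cons by (auto simp: agree_def)
    have "agree (Suc (length \<mu>)) (component e i) (component e' i)" for i
      using Cons.prems Cons by (auto simp: agree_def component_def)
    then have "shuffle_prod (component e i) (psi e \<eta> f) \<mu> = shuffle_prod (component e' i) (psi e' \<eta> f) \<mu>" for i
      using ag by (intro shuffle_cong)
    moreover have "shuffle_prod h (psi e \<eta> f) \<mu> = shuffle_prod h (psi e' \<eta> f) \<mu>" for h
      using ag by (intro shuffle_cong) (auto simp: agree_def)
    ultimately show ?thesis using Cons by (cases x) auto
  qed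
qed simp

lemma phi_cong: "agree (length \<nu>) e e' \<Longrightarrow> phi e \<eta> f \<nu> = phi e' \<eta> f \<nu>"
proof (induction \<eta> arbitrary: \<nu>)
  case (Cons x \<eta>)
  show ?case
  proof (cases \<nu>)
    case Nil
    then show ?thesis by (cases x) auto
  next
    case (Cons y \<mu>)
    have ag: "agree (Suc (length \<mu>)) (phi e \<eta> f) (phi e' \<eta> f)"
      unfolding agree_def using Cons.prems Cons.IH Cons by (auto simp: agree_def)
    have "agree (Suc (length \<mu>)) (component e i) (component e' i)" for i
      using Cons.prems Cons by (auto simp: agree_def component_def)
    then have "shuffle_prod (component e i) (phi e \<eta> f) \<mu> = shuffle_prod (component e' i) (phi e' \<eta> f) \<mu>" for i
      using ag by (intro shuffle_cong)
    moreover have "shuffle_prod h (phi e \<eta> f) \<mu> = shuffle_prod h (phi e' \<eta> f) \<mu>" for h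
      using ag by (intro shuffle_cong) (auto simp: agree_def)
    moreover have "phi e \<eta> f \<mu> = phi e' \<eta> f \<mu>"
      using ag by (simp add: agree_def)
    ultimately show ?thesis using Cons by (cases x) auto
  qed
qed simp

lemma agree_comp_prod: "agree n e e' \<Longrightarrow> agree (Suc n) (comp_prod d e) (comp_prod d e')"
  unfolding agree_def[of "Suc n"] comp_prod_def
  by (auto intro!: Sum_any.cong arg_cong2[where f = scaleR] psi_cong simp: agree_def)

lemma agree_mod_comp_prod: "agree n e e' \<Longrightarrow> agree (Suc n) (mod_comp_prod c e) (mod_comp_prod c e')"
  unfolding agree_def[of "Suc n"] mod_comp_prod_def
  by (auto intro!: Sum_any.cong arg_cong2[where f = scaleR] phi_cong simp: agree_def)

lemma ex1_fixpoint:
  fixes T :: "('x, 'b :: zero) series \<Rightarrow> ('x, 'b) series"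
  assumes T: "\<And>n e e'. agree n e e' \<Longrightarrow> agree (Suc n) (T e) (T e')"
  shows "\<exists>!e. T e = e"
proof (rule ex_ex1I)
  define E where "E n = (T ^^ n) (\<lambda>_. 0)" for n
  have step: "agree n (E n) (E (Suc n))" for n
  proof (induction n)
    case 0
    show ?case by (simp add: agree_def)
  next
    case (Suc n)
    then show ?case using T[OF Suc] by (simp add: E_def)
  qed
  have stable: "agree n (E n) (E (n + k))" for n k
  proof (induction k)
    case 0
    show ?case by (simp add: agree_def)
  next
    case (Suc k)
    then show ?case using step[of "n + k"] by (auto simp: agree_def)
  qed
  define e where "e \<nu> = E (Suc (length \<nu>)) \<nu>" for \<nu>
  have lim: "agree n (E n) e" for n
    unfolding agree_def
  proof (intro allI impI)
    fix \<nu> :: "'x list" assume "length \<nu> < n"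
    then show "E n \<nu> = e \<nu>"
      using stable[of "Suc (length \<nu>)" "n - Suc (length \<nu>)"] by (simp add: agree_def e_def)
  qed
  have "T e \<nu> = e \<nu>" for \<nu>
  proof -
    let ?n = "length \<nu>"
    have "T e \<nu> = T (E ?n) \<nu>"
      using T[OF lim[of ?n]] by (simp add: agree_def)
    also have "\<dots> = E (Suc ?n) \<nu>"
      by (simp add: E_def)
    finally show ?thesis
      by (simp add: e_def)
  qed
  then show "\<exists>e. T e = e"
    by blast
next
  fix e e' assume e: "T e = e" "T e' = e'"
  have "agree n e e'" for n
  proof (induction n)
    case 0
    show ?case by (simp add: agree_def)
  next
    case (Suc n)
    then show ?case using T[OF Suc] e by simp
  qed
  then show "e = e'"
    by (auto simp: agree_def fun_eq_iff)
qed

lemma ex1_feedback: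
  fixes c :: "('p :: finite option, real ^ 'q :: finite) series"
    and d :: "('q option, real ^ 'p) series"
  shows "\<exists>!e. mod_comp_prod c (comp_prod d e) = e"
proof (rule ex1_fixpoint)
  fix n and e e' :: "('p option, real ^ 'q) series"
  assume "agree n e e'"
  then have "agree (Suc (Suc n)) (mod_comp_prod c (comp_prod d e)) (mod_comp_prod c (comp_prod d e'))"
    by (intro agree_mod_comp_prod agree_comp_prod)
  then show "agree (Suc n) (mod_comp_prod c (comp_prod d e)) (mod_comp_prod c (comp_prod d e'))"
    by (simp add: agree_def)
qed

lemma feedback_fixpoint: "mod_comp_prod c (comp_prod d (feedback_prod c d)) = feedback_prod c d"
  unfolding feedback_prod_def by (rule theI'[OF ex1_feedback])

end

theory Submission
  imports Defs
begin

text \<open>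
  Bound a series by the power series whose \<open>n\<close>-th coefficient is the largest coefficient on words
  of length \<open>n\<close>, divided by \<open>n!\<close>. Shuffles are then bounded by products and the adjunction of a
  letter by integration, so that \<open>c\<close> composed with \<open>e\<close> is bounded by \<open>K / (1 - M W)\<close>, where
  \<open>W' = 1 + m E\<close> and \<open>E\<close> bounds \<open>e\<close>. Let \<open>r\<close> be so small that \<open>M r (1 + 2 m K) \<le> 1/2\<close>. If the
  truncation of \<open>E\<close> to degree less than \<open>n\<close> is at most \<open>2 K\<close> at \<open>r\<close>, then \<open>W\<close> truncated to degree
  at most \<open>n\<close> is at most \<open>1 / (2 M)\<close> there, and the composition truncated to degree at most \<open>n\<close>
  is again at most \<open>2 K\<close>. Applied to both compositions in the feedback equation, this bounds all
  truncations by \<open>2 K\<close>, and hence the coefficients on words of length \<open>n\<close> by \<open>2 K r\<^sup>-\<^sup>n n!\<close>.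
\<close>

subsection \<open>Majorants of shuffles\<close>

text \<open>The two cut-offs are independent because stripping a first letter from one factor
  shortens the range of that factor only.\<close>

lemma shuffle_prod_eq_sum:
  fixes f g :: "('x :: finite, real) series"
  assumes "length \<nu> \<le> m" "length \<nu> \<le> n"
  shows "shuffle_prod f g \<nu> =
    (\<Sum>\<eta> | length \<eta> \<le> m. \<Sum>\<xi> | length \<xi> \<le> n. f \<eta> * g \<xi> * word_shuffle \<eta> \<xi> \<nu>)"
proof -
  let ?W = "\<lambda>n. {\<eta> :: 'x list. length \<eta> \<le> n}"
  have "{z. (case z of (\<eta>, \<xi>) \<Rightarrow> f \<eta> * g \<xi> * word_shuffle \<eta> \<xi> \<nu>) \<noteq> 0} \<subseteq> ?W m \<times> ?W n"
    using assms word_shuffle_length[of _ _ \<nu>] by fastforce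
  then have "shuffle_prod f g \<nu> =
      (\<Sum>(\<eta>, \<xi>)\<in>?W m \<times> ?W n. f \<eta> * g \<xi> * word_shuffle \<eta> \<xi> \<nu>)"
    unfolding shuffle_prod_def
    by (intro Sum_any.expand_superset finite_cartesian_product finite_words_upto)
  then show ?thesis
    by (simp add: sum.cartesian_product)
qed

lemma shuffle_prod_Nil:
  fixes f g :: "('x :: finite, real) series"
  shows "shuffle_prod f g [] = f [] * g []"
proof -
  have "{\<eta> :: 'x list. length \<eta> \<le> 0} = {[]}" by auto
  then show ?thesis
    by (subst shuffle_prod_eq_sum[of _ 0 0]) (simp_all add: word_series_def)
qed

lemma word_shuffle_Nil_right: "word_shuffle \<eta> [] = word_series \<eta>"
  by (cases \<eta>) simp_all

text \<open>The first letter of a word in a shuffle comes from one of the two factors.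
  \<open>lmul\<close> acts here on the factor words instead of the resulting word: it vanishes
  unless that factor begins with \<open>x\<close>, so empty factors need no separate
  formula.\<close>

lemma word_shuffle_Cons_apply:
  "word_shuffle \<eta> \<xi> (x # \<mu>) =
    lmul x (\<lambda>\<eta>'. word_shuffle \<eta>' \<xi> \<mu>) \<eta> + lmul x (\<lambda>\<xi>'. word_shuffle \<eta> \<xi>' \<mu>) \<xi>"
proof (cases \<eta>)
  case Nil
  then show ?thesis by (cases \<xi>) (simp_all add: word_series_def)
next
  case (Cons y \<eta>')
  then show ?thesis by (cases \<xi>) (simp_all add: word_shuffle_Nil_right word_series_def)
qed

lemma sum_lmul_words_upto:
  fixes h :: "('x :: finite, real) series"
  shows "(\<Sum>\<eta> | length \<eta> \<le> Suc n. lmul x h \<eta>) = (\<Sum>\<eta> | length \<eta> \<le> n. h \<eta>)"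
proof -
  have "(\<Sum>\<eta> | length \<eta> \<le> Suc n. lmul x h \<eta>) = (\<Sum>\<eta>\<in>(#) x ` {\<eta>. length \<eta> \<le> n}. lmul x h \<eta>)"
  proof (rule sum.mono_neutral_right)
    show "\<forall>\<eta>\<in>{\<eta>. length \<eta> \<le> Suc n} - (#) x ` {\<eta>. length \<eta> \<le> n}. lmul x h \<eta> = 0"
    proof
      fix \<eta> assume "\<eta> \<in> {\<eta>. length \<eta> \<le> Suc n} - (#) x ` {\<eta>. length \<eta> \<le> n}"
      then show "lmul x h \<eta> = 0" by (cases \<eta>) auto
    qed
  qed (auto simp: finite_words_upto)
  also have "\<dots> = (\<Sum>\<eta> | length \<eta> \<le> n. h \<eta>)"
    by (subst sum.reindex) simp_all
  finally show ?thesis .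
qed

lemma mult_lmul: "f \<eta> * lmul x h \<eta> = lmul x (\<lambda>\<eta>'. f (x # \<eta>') * h \<eta>') \<eta>"
  by (cases \<eta>) simp_all

text \<open>Stripping the leading letter \<open>x\<close> is a derivation of the shuffle algebra;
  this is its Leibniz rule, and it allows induction on the word at which a shuffle is
  evaluated.\<close>

lemma shuffle_prod_Cons:
  fixes f g :: "('x :: finite, real) series"
  shows "shuffle_prod f g (x # \<mu>) =
    shuffle_prod (\<lambda>\<eta>. f (x # \<eta>)) g \<mu> + shuffle_prod f (\<lambda>\<xi>. g (x # \<xi>)) \<mu>"
proof -
  let ?n = "length \<mu>"
  let ?W = "\<lambda>n. {\<eta> :: 'x list. length \<eta> \<le> n}"
  have "shuffle_prod f g (x # \<mu>) =
      (\<Sum>\<eta>\<in>?W (Suc ?n). \<Sum>\<xi>\<in>?W (Suc ?n). f \<eta> * g \<xi> * word_shuffle \<eta> \<xi> (x # \<mu>))"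
    by (rule shuffle_prod_eq_sum) simp_all
  also have "\<dots> =
      (\<Sum>\<xi>\<in>?W (Suc ?n). \<Sum>\<eta>\<in>?W (Suc ?n). f \<eta> * lmul x (\<lambda>\<eta>'. g \<xi> * word_shuffle \<eta>' \<xi> \<mu>) \<eta>) +
      (\<Sum>\<eta>\<in>?W (Suc ?n). \<Sum>\<xi>\<in>?W (Suc ?n). g \<xi> * lmul x (\<lambda>\<xi>'. f \<eta> * word_shuffle \<eta> \<xi>' \<mu>) \<xi>)"
  proof -
    have eq: "f \<eta> * g \<xi> * word_shuffle \<eta> \<xi> (x # \<mu>) =
        f \<eta> * lmul x (\<lambda>\<eta>'. g \<xi> * word_shuffle \<eta>' \<xi> \<mu>) \<eta> +
        g \<xi> * lmul x (\<lambda>\<xi>'. f \<eta> * word_shuffle \<eta> \<xi>' \<mu>) \<xi>" for \<eta> \<xi>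
      by (simp only: word_shuffle_Cons_apply) (auto simp: lmul_def algebra_simps split: list.splits)
    \<comment> \<open>Only the first double sum is swapped, so that in both the inner variable is
      the argument of \<open>lmul\<close>, as \<open>sum_lmul_words_upto\<close> requires.\<close>
    show ?thesis
      unfolding eq sum.distrib by (rule arg_cong2[where f = "(+)"], rule sum.swap, rule refl)
  qed
  also have "(\<Sum>\<xi>\<in>?W (Suc ?n). \<Sum>\<eta>\<in>?W (Suc ?n). f \<eta> * lmul x (\<lambda>\<eta>'. g \<xi> * word_shuffle \<eta>' \<xi> \<mu>) \<eta>)
      = shuffle_prod (\<lambda>\<eta>. f (x # \<eta>)) g \<mu>"
    unfolding mult_lmul sum_lmul_words_upto
    by (subst sum.swap) (simp add: shuffle_prod_eq_sum[of _ ?n "Suc ?n"] mult.assoc)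
  also have "(\<Sum>\<eta>\<in>?W (Suc ?n). \<Sum>\<xi>\<in>?W (Suc ?n). g \<xi> * lmul x (\<lambda>\<xi>'. f \<eta> * word_shuffle \<eta> \<xi>' \<mu>) \<xi>)
      = shuffle_prod f (\<lambda>\<xi>. g (x # \<xi>)) \<mu>"
    unfolding mult_lmul sum_lmul_words_upto
    by (simp add: shuffle_prod_eq_sum[of _ "Suc ?n" ?n] ac_simps)
  finally show ?thesis .
qed

lemma shuffle_prod_one:
  fixes f :: "('x :: finite, real) series"
  shows "shuffle_prod (word_series []) f \<nu> = f \<nu>"
proof (induction \<nu> arbitrary: f)
  case Nil
  show ?case by (simp add: shuffle_prod_Nil word_series_def)
next
  case (Cons x \<mu>)
  have "shuffle_prod (\<lambda>\<eta>. word_series [] (x # \<eta>)) f \<mu> = 0"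
    by (simp add: word_series_def shuffle_prod_eq_sum[of _ "length \<mu>" "length \<mu>"])
  then show ?case by (simp add: shuffle_prod_Cons Cons)
qed

lemma fact_mult_fps_deriv_nth:
  "fact n * fps_nth (fps_deriv A) n = fact (Suc n) * fps_nth A (Suc n)" for A :: "real fps"
  by (simp add: algebra_simps)

text \<open>With coefficients scaled by n!, stripping a letter becomes \<open>fps_deriv\<close>, so
  the Leibniz rule for shuffles turns into the one for \<open>A * B\<close>. A whole family
  \<open>g\<close> is treated at once so that later all words of a given length share one
  bound.\<close>

lemma sum_abs_shuffle_prod_le:
  fixes f :: "('x :: finite, real) series" and g :: "'i \<Rightarrow> ('x, real) series"
  assumes "\<And>\<nu>. \<bar>f \<nu>\<bar> \<le> fact (length \<nu>) * fps_nth A (length \<nu>)"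
    and "\<And>\<nu>. (\<Sum>i\<in>I. \<bar>g i \<nu>\<bar>) \<le> fact (length \<nu>) * fps_nth B (length \<nu>)"
  shows "(\<Sum>i\<in>I. \<bar>shuffle_prod f (g i) \<nu>\<bar>) \<le> fact (length \<nu>) * fps_nth (A * B) (length \<nu>)"
  using assms
proof (induction \<nu> arbitrary: f g A B)
  case Nil
  have "(\<Sum>i\<in>I. \<bar>shuffle_prod f (g i) []\<bar>) = \<bar>f []\<bar> * (\<Sum>i\<in>I. \<bar>g i []\<bar>)"
    by (simp add: shuffle_prod_Nil abs_mult sum_distrib_left)
  also have "\<dots> \<le> fps_nth A 0 * fps_nth B 0"
    using Nil(1)[of "[]"] Nil(2)[of "[]"] by (intro mult_mono) (auto intro: sum_nonneg)
  finally show ?case by simp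
next
  case (Cons x \<mu>)
  let ?n = "length \<mu>"
  have f': "\<bar>f (x # \<nu>)\<bar> \<le> fact (length \<nu>) * fps_nth (fps_deriv A) (length \<nu>)" for \<nu>
    using Cons.prems(1)[of "x # \<nu>"] by (simp add: algebra_simps)
  have g': "(\<Sum>i\<in>I. \<bar>g i (x # \<nu>)\<bar>) \<le> fact (length \<nu>) * fps_nth (fps_deriv B) (length \<nu>)" for \<nu>
    using Cons.prems(2)[of "x # \<nu>"] by (simp add: algebra_simps)
  have "(\<Sum>i\<in>I. \<bar>shuffle_prod f (g i) (x # \<mu>)\<bar>) \<le>
      (\<Sum>i\<in>I. \<bar>shuffle_prod (\<lambda>\<nu>. f (x # \<nu>)) (g i) \<mu>\<bar> + \<bar>shuffle_prod f (\<lambda>\<nu>. g i (x # \<nu>)) \<mu>\<bar>)"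
    by (intro sum_mono) (simp add: shuffle_prod_Cons abs_triangle_ineq)
  also have "\<dots> \<le> fact ?n * fps_nth (fps_deriv A * B) ?n + fact ?n * fps_nth (A * fps_deriv B) ?n"
    unfolding sum.distrib
    by (intro add_mono Cons.IH[OF f' Cons.prems(2)] Cons.IH[OF Cons.prems(1) g'])
  also have "\<dots> = fact ?n * fps_nth (fps_deriv (A * B)) ?n"
    by (simp add: algebra_simps del: fps_deriv_nth)
  also have "\<dots> = fact (length (x # \<mu>)) * fps_nth (A * B) (length (x # \<mu>))"
    by (simp only: length_Cons fact_mult_fps_deriv_nth)
  finally show ?case .
qed


subsection \<open>Truncated evaluation of power series\<close>

text \<open>A finite sum raises no question of convergence before the bound is proved. Degrees lie
  strictly below \<open>n\<close>, so \<open>n = 0\<close> gives 0 and starts the final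
  induction.\<close>

definition trunc_eval :: "nat \<Rightarrow> real \<Rightarrow> real fps \<Rightarrow> real" where
  "trunc_eval n r A = (\<Sum>j<n. fps_nth A j * r ^ j)"

text \<open>The truncated product sums over the triangle i + j < n, the product of the truncations
  over the surrounding square, and all terms are nonnegative.\<close>

lemma trunc_eval_mult_le:
  assumes "\<And>j. 0 \<le> fps_nth A j" "\<And>j. 0 \<le> fps_nth B j" "0 \<le> r"
  shows "trunc_eval n r (A * B) \<le> trunc_eval n r A * trunc_eval n r B"
proof -
  let ?h = "\<lambda>i j. (fps_nth A i * r ^ i) * (fps_nth B j * r ^ j)"
  have "trunc_eval n r (A * B) = (\<Sum>k<n. \<Sum>i\<le>k. ?h i (k - i))"
    unfolding trunc_eval_def fps_mult_nth atLeast0AtMost sum_distrib_right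
    by (intro sum.cong refl) (auto simp: power_add[symmetric] mult_ac)
  also have "\<dots> = (\<Sum>(i, j)\<in>{(i, j). i + j < n}. ?h i j)"
    by (rule sum.triangle_reindex[symmetric])
  also have "\<dots> \<le> (\<Sum>(i, j)\<in>{..<n} \<times> {..<n}. ?h i j)"
    using assms by (intro sum_mono2) auto
  also have "\<dots> = trunc_eval n r A * trunc_eval n r B"
    by (simp add: trunc_eval_def sum_product sum.cartesian_product)
  finally show ?thesis .
qed

lemma fps_power_nonneg:
  fixes A :: "real fps"
  assumes "\<And>j. 0 \<le> fps_nth A j"
  shows "0 \<le> fps_nth (A ^ k) j"
proof (induction k arbitrary: j)
  case (Suc k)
  then show ?case using assms by (auto simp: fps_mult_nth intro!: sum_nonneg)
qed simp

lemma trunc_eval_nonneg: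
  assumes "\<And>j. 0 \<le> fps_nth A j" "0 \<le> r"
  shows "0 \<le> trunc_eval n r A"
  unfolding trunc_eval_def using assms by (intro sum_nonneg) auto

lemma trunc_eval_one: "trunc_eval n r 1 = (if 0 < n then 1 else 0)"
  unfolding trunc_eval_def by (simp add: if_distrib[of "\<lambda>u. u * _"] cong: if_cong)

lemma trunc_eval_power_le:
  assumes "\<And>j. 0 \<le> fps_nth A j" "0 \<le> r"
  shows "trunc_eval n r (A ^ k) \<le> trunc_eval n r A ^ k"
proof (induction k)
  case 0
  show ?case by (simp add: trunc_eval_one)
next
  case (Suc k)
  have "trunc_eval n r (A ^ Suc k) \<le> trunc_eval n r A * trunc_eval n r (A ^ k)"
    using trunc_eval_mult_le[OF assms(1) fps_power_nonneg[OF assms(1)] assms(2)] by simp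
  also have "\<dots> \<le> trunc_eval n r A * trunc_eval n r A ^ k"
    using Suc by (intro mult_left_mono trunc_eval_nonneg assms)
  finally show ?case by simp
qed

text \<open>Integration raises degrees by one, hence \<open>Suc n\<close> against \<open>n\<close>.
  This shift drives the final induction; the divisors j + 1 are estimated by 1.\<close>

lemma trunc_eval_integral_le:
  assumes "\<And>j. 0 \<le> fps_nth A j" "0 \<le> r"
  shows "trunc_eval (Suc n) r (fps_integral0 A) \<le> r * trunc_eval n r A"
proof -
  have "trunc_eval (Suc n) r (fps_integral0 A) = (\<Sum>j<n. fps_nth A j / (real j + 1) * r ^ Suc j)"
    unfolding trunc_eval_def by (subst sum.lessThan_Suc_shift) (simp add: divide_inverse ac_simps)
  also have "\<dots> \<le> (\<Sum>j<n. fps_nth A j * r ^ Suc j)"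
  proof (intro sum_mono mult_right_mono)
    fix j
    have "fps_nth A j * 1 \<le> fps_nth A j * (real j + 1)"
      using assms by (intro mult_left_mono) auto
    then show "fps_nth A j / (real j + 1) \<le> fps_nth A j"
      by (simp add: divide_le_eq)
  qed (use assms in auto)
  also have "\<dots> = r * trunc_eval n r A"
    by (simp add: trunc_eval_def sum_distrib_left ac_simps)
  finally show ?thesis .
qed


subsection \<open>Majorants of compositions\<close>

lemma finite_words: "finite {\<eta> :: 'x :: finite list. length \<eta> = n}"
  by (rule finite_subset[OF _ finite_words_upto[of n]]) auto

definition majorant :: "('x :: finite, real ^ 'l :: finite) series \<Rightarrow> real fps" where
  "majorant c = Abs_fps (\<lambda>n. (MAX \<nu>\<in>{\<nu>. length \<nu> = n}. infnorm (c \<nu>)) / fact n)"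

lemma infnorm_le_majorant:
  "infnorm (c \<nu>) \<le> fact (length \<nu>) * fps_nth (majorant c) (length \<nu>)"
  by (auto simp: majorant_def finite_words intro!: Max_ge)

lemma majorant_least:
  fixes c :: "('x :: finite, real ^ 'l :: finite) series"
  assumes "\<And>\<nu>. length \<nu> = n \<Longrightarrow> infnorm (c \<nu>) \<le> fact n * b"
  shows "fps_nth (majorant c) n \<le> b"
proof -
  \<comment> \<open>Some word of length \<open>n\<close> must exist for the maximum to be over a
    nonempty set.\<close>
  have "replicate n undefined \<in> {\<nu> :: 'x list. length \<nu> = n}"
    by simp
  then have "{\<nu> :: 'x list. length \<nu> = n} \<noteq> {}"
    by blast
  then have "(MAX \<nu>\<in>{\<nu>. length \<nu> = n}. infnorm (c \<nu>)) \<le> fact n * b"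
    using assms by (subst Max_le_iff) (auto simp: finite_words)
  then show ?thesis
    by (simp add: majorant_def divide_le_eq mult.commute)
qed

lemma majorant_nonneg: "0 \<le> fps_nth (majorant c) n"
proof -
  have "0 \<le> infnorm (c (replicate n undefined))"
    by (rule infnorm_pos_le)
  also have "\<dots> \<le> fact n * fps_nth (majorant c) n"
    using infnorm_le_majorant[of c "replicate n undefined"] by simp
  finally show ?thesis by (rule mult_left_le_imp_le[of "fact n" 0, simplified]) simp
qed

lemma infnorm_sum_le: "infnorm (\<Sum>i\<in>I. f i) \<le> (\<Sum>i\<in>I. infnorm (f i))"
proof (induction I rule: infinite_finite_induct)
  case (insert i I)
  then show ?case using infnorm_triangle[of "f i" "\<Sum>i\<in>I. f i"] by simp
qed (simp_all add: infnorm_0)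

lemma sum_words_Suc:
  fixes h :: "'x :: finite list \<Rightarrow> real"
  shows "(\<Sum>\<eta> | length \<eta> = Suc k. h \<eta>) = (\<Sum>\<eta> | length \<eta> = k. \<Sum>x\<in>UNIV. h (x # \<eta>))"
proof -
  have eq: "{\<eta> :: 'x list. length \<eta> = Suc k} = (\<lambda>(\<eta>, x). x # \<eta>) ` ({\<eta>. length \<eta> = k} \<times> UNIV)"
    by (auto simp: length_Suc_conv)
  show ?thesis
    unfolding eq by (subst sum.reindex) (auto simp: inj_on_def sum.cartesian_product case_prod_unfold)
qed

text \<open>The common features of \<^const>\<open>psi\<close> and \<^const>\<open>phi\<close>, applied to the unit series.\<close>

locale word_family =
  fixes e :: "('p :: finite option, real ^ 'm :: finite) series"
    and g :: "'m option list \<Rightarrow> ('p option, real) series"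
  assumes g_Nil: "g [] = word_series []"
    and g_Cons_Nil: "g (x # \<eta>) [] = 0"
    and g_Cons_Cons: "(\<Sum>x\<in>UNIV. \<bar>g (x # \<eta>) (y # \<mu>)\<bar>) \<le>
      \<bar>g \<eta> \<mu>\<bar> + (\<Sum>i\<in>UNIV. \<bar>shuffle_prod (component e i) (g \<eta>) \<mu>\<bar>)"
    and g_eq_0: "length \<nu> < length \<eta> \<Longrightarrow> g \<eta> \<nu> = 0"
begin

text \<open>The integrand mirrors \<open>g_Cons_Cons\<close>: 1 stands for the term without a
  shuffle, the other summand for the shuffles with the components of \<open>e\<close>.\<close>

definition W :: "real fps" where
  "W = fps_integral0 (1 + fps_const (real CARD('m)) * majorant e)"

lemma W_nonneg: "0 \<le> fps_nth W n"
proof -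
  have "0 \<le> fps_nth (1 + fps_const (real CARD('m)) * majorant e) j" for j
    by (simp add: majorant_nonneg)
  then show ?thesis by (cases n) (simp_all add: W_def del: fps_add_nth)
qed

lemma trunc_eval_W_le:
  assumes "0 \<le> r" "trunc_eval n r (majorant e) \<le> B" "0 \<le> B"
  shows "trunc_eval (Suc n) r W \<le> r * (1 + real CARD('m) * B)"
proof -
  let ?A = "1 + fps_const (real CARD('m)) * majorant e"
  have "trunc_eval (Suc n) r W \<le> r * trunc_eval n r ?A"
    unfolding W_def by (rule trunc_eval_integral_le) (auto simp: majorant_nonneg assms)
  also have "trunc_eval n r ?A = trunc_eval n r 1 + real CARD('m) * trunc_eval n r (majorant e)"
    by (simp add: trunc_eval_def sum.distrib sum_distrib_left algebra_simps)
  also have "trunc_eval n r 1 \<le> 1"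
    by (simp add: trunc_eval_one)
  finally show ?thesis
    using assms by (simp add: mult_left_mono order_trans)
qed

text \<open>Each letter of the word costs one integration against W', and the k-fold iterated
  integral is W^k / k!, since (W^(k+1) / (k+1)!)' = W' W^k / k!. Summing over all words of length
  \<open>k\<close> lets the number of letters enter only through \<open>W\<close>.\<close>

lemma sum_abs_words_le:
  "(\<Sum>\<eta> | length \<eta> = k. \<bar>g \<eta> \<nu>\<bar>) \<le> fact (length \<nu>) * fps_nth (fps_const (1 / fact k) * W ^ k) (length \<nu>)"
proof (induction k arbitrary: \<nu>)
  case 0
  show ?case by (cases \<nu>) (simp_all add: g_Nil word_series_def)
next
  case (Suc k)
  let ?F = "\<lambda>k. fps_const (1 / fact k) * W ^ k"
  show ?case
  proof (cases \<nu>)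
    case Nil
    then show ?thesis
      by (simp add: sum_words_Suc g_Cons_Nil W_def)
  next
    case (Cons y \<mu>)
    let ?n = "length \<mu>"
    let ?D = "1 + fps_const (real CARD('m)) * majorant e"
    have comp: "\<bar>component e i \<nu>\<bar> \<le> fact (length \<nu>) * fps_nth (majorant e) (length \<nu>)" for i \<nu>
      using component_le_infnorm_cart[of "e \<nu>" i] infnorm_le_majorant[of e \<nu>]
      by (simp add: component_def)
    have "(\<Sum>\<eta> | length \<eta> = Suc k. \<bar>g \<eta> \<nu>\<bar>) \<le>
        (\<Sum>\<eta> | length \<eta> = k. \<bar>g \<eta> \<mu>\<bar> + (\<Sum>i\<in>UNIV. \<bar>shuffle_prod (component e i) (g \<eta>) \<mu>\<bar>))"
      unfolding sum_words_Suc Cons by (intro sum_mono g_Cons_Cons)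
    also have "\<dots> = (\<Sum>\<eta> | length \<eta> = k. \<bar>g \<eta> \<mu>\<bar>) +
        (\<Sum>i\<in>UNIV. \<Sum>\<eta> | length \<eta> = k. \<bar>shuffle_prod (component e i) (g \<eta>) \<mu>\<bar>)"
      by (simp add: sum.distrib sum.swap[of _ UNIV])
    also have "\<dots> \<le> fact ?n * fps_nth (?F k) ?n +
        (\<Sum>i\<in>(UNIV :: 'm set). fact ?n * fps_nth (majorant e * ?F k) ?n)"
      by (intro add_mono sum_mono Suc.IH sum_abs_shuffle_prod_le comp)
    also have "\<dots> = fact ?n * fps_nth (?D * ?F k) ?n"
      by (simp only: distrib_right mult_1_left mult.assoc fps_add_nth fps_mult_left_const_nth
          sum_constant) (simp add: distrib_left)
    also have "?D * ?F k = fps_deriv (?F (Suc k))"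
    proof -
      have "fps_deriv W = ?D"
        by (simp add: W_def fps_deriv_fps_integral)
      then have "fps_deriv (?F (Suc k)) = fps_const (1 / fact (Suc k) * real (Suc k)) * (?D * W ^ k)"
        by (simp only: fps_deriv_mult_const_left fps_deriv_power diff_Suc_1 mult.assoc
            flip: fps_const_mult)
      also have "1 / fact (Suc k) * real (Suc k) = 1 / fact k"
        by (simp only: fact_Suc) (simp del: of_nat_Suc)
      finally show ?thesis
        by (simp add: ac_simps)
    qed
    finally show ?thesis
      by (simp only: Cons length_Cons fact_mult_fps_deriv_nth)
  qed
qed

text \<open>Grouping words by length, the factorial in the bound on \<open>c\<close> cancels the 1 /
  k! of \<open>sum_abs_words_le\<close>; what remains is the geometric series in M W.\<close>

lemma sum_scaleR_words_le:
  fixes c :: "('m option, real ^ 'l :: finite) series"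
  assumes c: "\<And>\<eta>. infnorm (c \<eta>) \<le> K * M ^ length \<eta> * fact (length \<eta>)" and "0 \<le> K" "0 \<le> M"
  shows "infnorm (Sum_any (\<lambda>\<eta>. g \<eta> \<nu> *\<^sub>R c \<eta>)) \<le>
    fact (length \<nu>) * (\<Sum>k\<le>length \<nu>. K * M ^ k * fps_nth (W ^ k) (length \<nu>))"
proof -
  let ?n = "length \<nu>"
  have "Sum_any (\<lambda>\<eta>. g \<eta> \<nu> *\<^sub>R c \<eta>) = (\<Sum>\<eta> | length \<eta> \<le> ?n. g \<eta> \<nu> *\<^sub>R c \<eta>)"
    by (rule Sum_any.expand_superset[OF finite_words_upto]) (auto intro: ccontr simp: g_eq_0)
  also have "infnorm \<dots> \<le> (\<Sum>\<eta> | length \<eta> \<le> ?n. infnorm (g \<eta> \<nu> *\<^sub>R c \<eta>))"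
    by (rule infnorm_sum_le)
  also have "\<dots> \<le> (\<Sum>\<eta> | length \<eta> \<le> ?n. \<bar>g \<eta> \<nu>\<bar> * (K * M ^ length \<eta> * fact (length \<eta>)))"
    by (intro sum_mono) (simp add: infnorm_mul mult_left_mono c)
  also have "\<dots> = (\<Sum>k\<le>?n. \<Sum>\<eta> | \<eta> \<in> {\<eta>. length \<eta> \<le> ?n} \<and> length \<eta> = k.
      \<bar>g \<eta> \<nu>\<bar> * (K * M ^ length \<eta> * fact (length \<eta>)))"
    by (rule sum.group[symmetric]) (auto simp: finite_words_upto)
  also have "\<dots> = (\<Sum>k\<le>?n. (K * M ^ k * fact k) * (\<Sum>\<eta> | length \<eta> = k. \<bar>g \<eta> \<nu>\<bar>))"
    by (auto simp: sum_distrib_left mult.commute intro!: sum.cong)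
  also have "\<dots> \<le> (\<Sum>k\<le>?n. (K * M ^ k * fact k) * (fact ?n * fps_nth (fps_const (1 / fact k) * W ^ k) ?n))"
    using assms by (intro sum_mono mult_left_mono sum_abs_words_le) auto
  also have "\<dots> = fact ?n * (\<Sum>k\<le>?n. K * M ^ k * fps_nth (W ^ k) ?n)"
    by (simp add: sum_distrib_left mult_ac)
  finally show ?thesis .
qed

lemma trunc_eval_composition_le:
  fixes c :: "('m option, real ^ 'l :: finite) series"
  assumes c: "\<And>\<eta>. infnorm (c \<eta>) \<le> K * M ^ length \<eta> * fact (length \<eta>)"
    and KM: "0 \<le> K" "0 \<le> M" and r: "0 \<le> r" "M * (r * (1 + real CARD('m) * (2 * K))) \<le> 1 / 2"
    and e: "trunc_eval n r (majorant e) \<le> 2 * K"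
  shows "trunc_eval (Suc n) r (majorant (\<lambda>\<nu>. Sum_any (\<lambda>\<eta>. g \<eta> \<nu> *\<^sub>R c \<eta>))) \<le> 2 * K"
proof -
  let ?n = "Suc n"
  have pow: "0 \<le> fps_nth (W ^ k) j" for k j
    by (rule fps_power_nonneg[OF W_nonneg])
  define w where "w = M * trunc_eval ?n r W"
  have w: "0 \<le> w" "w \<le> 1 / 2"
    using mult_left_mono[OF trunc_eval_W_le[OF r(1) e] KM(2)] r(2) KM trunc_eval_nonneg[OF W_nonneg r(1)]
    by (auto simp: w_def)
  have "trunc_eval ?n r (majorant (\<lambda>\<nu>. Sum_any (\<lambda>\<eta>. g \<eta> \<nu> *\<^sub>R c \<eta>)))
      \<le> (\<Sum>j<?n. (\<Sum>k\<le>j. K * M ^ k * fps_nth (W ^ k) j) * r ^ j)"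
    unfolding trunc_eval_def
    using sum_scaleR_words_le[OF c KM] r
    by (intro sum_mono mult_right_mono majorant_least) auto
  \<comment> \<open>A range for \<open>k\<close> that does not depend on \<open>j\<close> allows the
    two sums to be exchanged.\<close>
  also have "\<dots> \<le> (\<Sum>j<?n. (\<Sum>k<?n. K * M ^ k * fps_nth (W ^ k) j) * r ^ j)"
    using pow KM r by (intro sum_mono mult_right_mono sum_mono2) auto
  also have "\<dots> = (\<Sum>k<?n. K * M ^ k * trunc_eval ?n r (W ^ k))"
    unfolding trunc_eval_def sum_distrib_left sum_distrib_right
    by (subst sum.swap) (simp add: mult.assoc)
  also have "\<dots> \<le> (\<Sum>k<?n. K * M ^ k * trunc_eval ?n r W ^ k)"
    using KM r by (intro sum_mono mult_left_mono trunc_eval_power_le W_nonneg) auto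
  also have "\<dots> = K * (\<Sum>k<?n. w ^ k)"
    by (simp only: w_def power_mult_distrib sum_distrib_left mult.assoc)
  also have "\<dots> \<le> K * 2"
  proof (rule mult_left_mono[OF _ KM(1)])
    have "(\<Sum>k<?n. w ^ k) \<le> (\<Sum>k<?n. (1 / 2) ^ k)"
      using w by (intro sum_mono power_mono)
    also have "\<dots> \<le> 2"
      by (simp add: sum_gp_strict)
    finally show "(\<Sum>k<?n. w ^ k) \<le> 2" .
  qed
  finally show ?thesis by simp
qed

end

lemma sum_UNIV_option: "(\<Sum>x\<in>UNIV. h x) = h None + (\<Sum>i\<in>UNIV. h (Some i))"
  for h :: "'m :: finite option \<Rightarrow> real"
  by (simp add: UNIV_option_conv sum.reindex)

text \<open>Every image begins with \<open>None\<close>. At such a word the drift letter contributes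
  the term without a shuffle, as the unit series is neutral, and each \<open>Some i\<close>
  contributes one shuffle.\<close>

lemma word_family_psi: "word_family e (\<lambda>\<eta>. psi e \<eta> (word_series []))"
  for e :: "('p :: finite option, real ^ 'q :: finite) series"
proof
  fix x :: "'q option" and \<eta>
  show "psi e (x # \<eta>) (word_series []) [] = 0"
    by (cases x) simp_all
next
  fix \<eta> y and \<mu> :: "'p option list"
  show "(\<Sum>x\<in>UNIV. \<bar>psi e (x # \<eta>) (word_series []) (y # \<mu>)\<bar>) \<le>
      \<bar>psi e \<eta> (word_series []) \<mu>\<bar> +
      (\<Sum>i\<in>UNIV. \<bar>shuffle_prod (component e i) (psi e \<eta> (word_series [])) \<mu>\<bar>)"
    by (cases y) (simp_all add: sum_UNIV_option shuffle_prod_one sum_nonneg)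
qed (simp_all add: psi_eq_0)

text \<open>At a word beginning with \<open>Some i\<close> only that letter contributes, without a
  shuffle; at one beginning with \<open>None\<close> the drift letter does so, and every
  \<open>Some i\<close> adds its shuffle.\<close>

lemma word_family_phi: "word_family e (\<lambda>\<eta>. phi e \<eta> (word_series []))"
  for e :: "('p :: finite option, real ^ 'p) series"
proof
  fix x :: "'p option" and \<eta>
  show "phi e (x # \<eta>) (word_series []) [] = 0"
    by (cases x) simp_all
next
  fix \<eta> y and \<mu> :: "'p option list"
  have "shuffle_prod (\<lambda>_. 0) f \<mu> = 0" for f :: "('p option, real) series"
    by (simp add: shuffle_prod_eq_sum[of _ "length \<mu>" "length \<mu>"])
  then show "(\<Sum>x\<in>UNIV. \<bar>phi e (x # \<eta>) (word_series []) (y # \<mu>)\<bar>) \<le>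
      \<bar>phi e \<eta> (word_series []) \<mu>\<bar> +
      (\<Sum>i\<in>UNIV. \<bar>shuffle_prod (component e i) (phi e \<eta> (word_series [])) \<mu>\<bar>)"
    by (cases y) (simp_all add: sum_UNIV_option sum_nonneg if_distrib[of abs] cong: if_cong)
qed (simp_all add: phi_eq_0)


subsection \<open>The feedback product\<close>

lemma locally_convergent_common_bounds:
  fixes c :: "('x, real ^ 'l) series" and d :: "('y, real ^ 'k) series"
  assumes "locally_convergent c" "locally_convergent d"
  obtains K M where "0 < K" "0 < M"
    and "\<And>\<eta>. infnorm (c \<eta>) \<le> K * M ^ length \<eta> * fact (length \<eta>)"
    and "\<And>\<eta>. infnorm (d \<eta>) \<le> K * M ^ length \<eta> * fact (length \<eta>)"
proof -
  obtain K1 M1 where 1: "0 < K1" "0 < M1" "\<And>\<eta>. infnorm (c \<eta>) \<le> K1 * M1 ^ length \<eta> * fact (length \<eta>)"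
    using assms(1) unfolding locally_convergent_def by blast
  obtain K2 M2 where 2: "0 < K2" "0 < M2" "\<And>\<eta>. infnorm (d \<eta>) \<le> K2 * M2 ^ length \<eta> * fact (length \<eta>)"
    using assms(2) unfolding locally_convergent_def by blast
  have mono: "K' * M' ^ n * fact n \<le> max K1 K2 * max M1 M2 ^ n * fact n"
    if "0 < K'" "0 < M'" "K' \<le> max K1 K2" "M' \<le> max M1 M2" for K' M' :: real and n
    using that by (intro mult_right_mono mult_mono power_mono) auto
  show ?thesis
  proof (rule that[of "max K1 K2" "max M1 M2"])
    show "infnorm (c \<eta>) \<le> max K1 K2 * max M1 M2 ^ length \<eta> * fact (length \<eta>)" for \<eta>
      using 1(3)[of \<eta>] mono[OF 1(1,2), of "length \<eta>"] by linarith
    show "infnorm (d \<eta>) \<le> max K1 K2 * max M1 M2 ^ length \<eta> * fact (length \<eta>)" for \<eta>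
      using 2(3)[of \<eta>] mono[OF 2(1,2), of "length \<eta>"] by linarith
  qed (use 1 2 in auto)
qed

theorem theorem10:
  fixes c :: "('p::finite option, real ^ 'q::finite) series"
    and d :: "('q option, real ^ 'p) series"
  assumes "locally_convergent c" and "locally_convergent d"
  shows "locally_convergent (feedback_prod c d)"
proof -
  obtain K M where KM: "0 < K" "0 < M"
    and c: "\<And>\<eta>. infnorm (c \<eta>) \<le> K * M ^ length \<eta> * fact (length \<eta>)"
    and d: "\<And>\<eta>. infnorm (d \<eta>) \<le> K * M ^ length \<eta> * fact (length \<eta>)"
    using locally_convergent_common_bounds[OF assms] by blast
  \<comment> \<open>The inner compositions run over different alphabets; \<open>m\<close> dominates
    both letter counts, so one radius \<open>r\<close> serves both.\<close>
  define m where "m = real CARD('p) + real CARD('q)"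
  define r where "r = 1 / (2 * M * (1 + m * (2 * K)))"
  have m: "0 < m" "real CARD('p) \<le> m" "real CARD('q) \<le> m"
    by (simp_all add: m_def add_pos_pos)
  have pos: "0 < 1 + m * (2 * K)"
    using m KM by (simp add: add_pos_pos)
  have r: "0 < r"
    using KM pos by (simp add: r_def)
  have Mr: "M * (r * (1 + k * (2 * K))) \<le> 1 / 2" if "k \<le> m" for k
  proof -
    have "M * (r * (1 + k * (2 * K))) \<le> M * (r * (1 + m * (2 * K)))"
      using that KM r by (intro mult_left_mono add_left_mono mult_right_mono) auto
    also have "\<dots> = 1 / 2"
      using KM pos by (simp add: r_def)
    finally show ?thesis .
  qed
  let ?e = "feedback_prod c d"
  have step: "trunc_eval (Suc n) r (majorant ?e) \<le> 2 * K"
    if "trunc_eval n r (majorant (comp_prod d ?e)) \<le> 2 * K" for n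
  proof -
    interpret word_family "comp_prod d ?e" "\<lambda>\<eta>. phi (comp_prod d ?e) \<eta> (word_series [])"
      by (rule word_family_phi)
    show ?thesis
      using trunc_eval_composition_le[OF c _ _ _ Mr that] KM r m
      by (simp flip: mod_comp_prod_def add: feedback_fixpoint)
  qed
  have step': "trunc_eval (Suc n) r (majorant (comp_prod d ?e)) \<le> 2 * K"
    if "trunc_eval n r (majorant ?e) \<le> 2 * K" for n
  proof -
    interpret word_family ?e "\<lambda>\<eta>. psi ?e \<eta> (word_series [])"
      by (rule word_family_psi)
    show ?thesis
      using trunc_eval_composition_le[OF d _ _ _ Mr that] KM r m
      by (simp flip: comp_prod_def)
  qed
  \<comment> \<open>The two bounds are proved together because each one at \<open>Suc n\<close>
    follows from the other at \<open>n\<close>.\<close>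
  have bound: "trunc_eval n r (majorant ?e) \<le> 2 * K \<and> trunc_eval n r (majorant (comp_prod d ?e)) \<le> 2 * K" for n
  proof (induction n)
    case 0
    show ?case using KM by (simp add: trunc_eval_def)
  qed (use step step' in blast)
  have "infnorm (?e \<nu>) \<le> 2 * K * (1 / r) ^ length \<nu> * fact (length \<nu>)" for \<nu>
  proof -
    let ?n = "length \<nu>"
    \<comment> \<open>The top term of a truncation with nonnegative terms is at most the
      whole.\<close>
    have "fps_nth (majorant ?e) ?n * r ^ ?n \<le> trunc_eval (Suc ?n) r (majorant ?e)"
      using trunc_eval_nonneg[OF majorant_nonneg, of r ?n ?e] r by (simp add: trunc_eval_def)
    also have "\<dots> \<le> 2 * K"
      using bound by blast
    finally have "fps_nth (majorant ?e) ?n \<le> 2 * K * (1 / r) ^ ?n"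
      using r by (simp add: field_simps)
    then have "fact ?n * fps_nth (majorant ?e) ?n \<le> 2 * K * (1 / r) ^ ?n * fact ?n"
      by (simp add: mult.commute)
    with infnorm_le_majorant[of ?e \<nu>] show ?thesis by linarith
  qed
  then show ?thesis
    unfolding locally_convergent_def using KM r
    by (intro exI[of _ "2 * K"] conjI exI[of _ "1 / r"]) auto
qed

end
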